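(* In the sparse functional data model and under Assumptions (A1)--(A6) of the context, with $C$ $G_q$-invariant, consider the projected smoother $\widehat C^{(q)}$ at its rate-optimal bandwidth, whose risk is of order $(nm^2q)^{-\beta/(\beta+1)}+n^{-1}$ for $q\le q^\sharp$ and $(c_Knm^2)^{-2\beta/(2\beta+1)}+n^{-1}$ for $q\ge q^\sharp$, where $q^\sharp=c_K^{(2\beta+2)/(2\beta+1)}(nm^2)^{1/(2\beta+1)}$. Let $m^*(q)$ be the sampling intensity $m$ at which the first term of this rate equals $n^{-1}$. The threshold associated with the saturated rate $(c_Knm^2)^{-2\beta/(2\beta+1)}+n^{-1}$ is $$m_\star\asymp c_K^{-1/2}\,n^{1/(4\beta)},$$ and $m^*(q)\ge m_\star$ for every $q$. Thus no rotation symmetry, however rich (including the full circle group), lowers the sparse--dense threshold of this estimator below order $n^{1/(4\beta)}$, and the bound is attained at $q=q^\sharp$.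
   Context: Model. $E=\mathbb S^1=\mathbb R/\mathbb Z$ with Lebesgue measure. One observes $Y_{ij}=X_i(T_{ij})+\varepsilon_{ij}$, $1\le i\le n$, $1\le j\le N_i$, where the $X_i$ are i.i.d. copies of a centred Gaussian element $X$ of $L^2(E)$ with covariance $C(s,t)=\operatorname{Cov}(X(s),X(t))$, the times $T_{ij}$ are i.i.d. with density $f$ on $E$, the errors $\varepsilon_{ij}$ are i.i.d. centred with variance $\sigma^2$, and the three families are independent. $m=m_n=\mathbb E N_i$. Estimator. $Z_{ijk}=Y_{ij}Y_{ik}$ for $j\ne k$, located at $(T_{ij},T_{ik})$. With $K_h(u)=h^{-1}K(u/h)$, $\widehat C_{n,h}(s,t)$ is the two-dimensional local-polynomial smoother of order $\lfloor\beta\rfloor$ of these data with product kernel: the constant coefficient of the polynomial $P$ of degree at most $\lfloor\beta\rfloor$ minimising $\sum_i\sum_{j\ne k}[Z_{ijk}-P(T_{ij}-s,T_{ik}-t)]^2K_h(T_{ij}-s)K_h(T_{ik}-t)$. For $q\ge1$, $G_q=\mathbb Z/q\mathbb Z$ acts on $E$ by $t\mapsto t+\ell/q$, $\Pi_qF(s,t)=q^{-1}\sum_{\ell=0}^{q-1}F(s+\ell/q,t+\ell/q)$, and $\widehat C^{(q)}_{n,h}=\Pi_q\widehat C_{n,h}$. $\mathcal Q$ is a finite family $1=q_0<q_1<\dots<q_J$ with $q_j\mid q_{j+1}$ of candidate orders. The rate-optimal bandwidths are $h_q\asymp(nm^2q)^{-1/(2\beta+2)}$ for $q\le q^\sharp$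 and $h^\sharp\asymp(c_Knm^2)^{-1/(2\beta+1)}$ for $q\ge q^\sharp$. $C$ is $G_q$-invariant if $C(s+1/q,t+1/q)=C(s,t)$. Assumptions. (A1) $C$ is Hölder of order $\beta\in(0,2]$ on $E\times E$ with $\|C\|_{C^\beta}\le R$. (A2) $0<a\le f\le b$. (A3) The counts form a triangular array, i.i.d. in $i$, with $\mathbb E N=m_n$, $\mathbb E[N(N-1)]\asymp m_n^2$, $\mathbb E[N^4]\lesssim m_n^4$ uniformly in $n$. (A4) There is $K_0>0$ with $\|X(t)\|_{L^p}\le K_0\sqrt p$ for all $t\in E$, $p\ge1$, and $\|\varepsilon\|_{L^p}\le K_0\sqrt p$. (A5) The design is $G_q$-invariant ($f(\cdot+1/q)=f$) for every $q\in\mathcal Q$. (A6) $K$ is symmetric, Lipschitz, supported in $[-1,1]$, $\int K=1$, and bandwidths satisfy $h<1/4$. Notation. $c_K=(\int K^2)^2/\int(K\star K)^2$. $a_n\asymp b_n$ means the ratio is bounded above and below by positive constants depending only on $\beta$, $R$, the constants in (A1)--(A6) and the kernel, never on $n,m_n,h,q$. Attainment at $q=q^\sharp$ refers to $q^\sharp$ evaluated at $m=m_\star$. *)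

theory Defs
  imports "HOL-Probability.Probability"
begin

text \<open>
  The circle \<open>E = \<real>/\<int>\<close> is represented by 1-periodic functions on \<open>\<real>\<close>, with integrals taken
  over one period. A rotation group is indexed by an extended natural number: \<open>enat q\<close> is the
  group of order \<open>q\<close> acting by \<open>t \<mapsto> t + l/q\<close>, and \<open>\<infinity>\<close> is the full circle group.
\<close>

definition periodic_fun1 :: "(real \<Rightarrow> real) \<Rightarrow> bool" where
  "periodic_fun1 f \<longleftrightarrow> (\<forall>t. f (t + 1) = f t)"

definition periodic_fun2 :: "(real \<Rightarrow> real \<Rightarrow> real) \<Rightarrow> bool" where
  "periodic_fun2 F \<longleftrightarrow> (\<forall>s t. F (s + 1) t = F s t \<and> F s (t + 1) = F s t)"

text \<open>Signed representative in \<open>[-1/2, 1/2)\<close> of a point of the circle.\<close>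

definition circ :: "real \<Rightarrow> real" where
  "circ u = u - of_int (round u)"

definition design_invariant :: "enat \<Rightarrow> (real \<Rightarrow> real) \<Rightarrow> bool" where
  "design_invariant q f \<longleftrightarrow>
     (case q of enat k \<Rightarrow> (\<forall>t. f (t + 1 / real k) = f t) | \<infinity> \<Rightarrow> (\<forall>u t. f (t + u) = f t))"

definition cov_invariant :: "enat \<Rightarrow> (real \<Rightarrow> real \<Rightarrow> real) \<Rightarrow> bool" where
  "cov_invariant q C \<longleftrightarrow>
     (case q of enat k \<Rightarrow> (\<forall>s t. C (s + 1 / real k) (t + 1 / real k) = C s t)
      | \<infinity> \<Rightarrow> (\<forall>u s t. C (s + u) (t + u) = C s t))"

definition rot_proj :: "enat \<Rightarrow> (real \<Rightarrow> real \<Rightarrow> real) \<Rightarrow> real \<Rightarrow> real \<Rightarrow> real" where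
  "rot_proj q F s t =
     (case q of enat k \<Rightarrow> (\<Sum>l<k. F (s + real l / real k) (t + real l / real k)) / real k
      | \<infinity> \<Rightarrow> (LINT u:{0..1}|lborel. F (s + u) (t + u)))"

text \<open>
  \<open>\<parallel>C\<parallel>\<close> in \<open>C\<^sup>\<beta>\<close> is at most \<open>R\<close>, for \<open>0 < \<beta> \<le> 2\<close>, the norm being the maximum of the sup norms and
  the Hoelder seminorm of the derivative of order \<open>\<lceil>\<beta>\<rceil> - 1\<close>; so \<open>\<beta> = 1\<close> means Lipschitz and
  \<open>\<beta> = 2\<close> means Lipschitz gradient. For periodic functions the Euclidean distance gives the
  same condition as the distance of the torus.
\<close>

definition holder_ball :: "real \<Rightarrow> real \<Rightarrow> (real \<Rightarrow> real \<Rightarrow> real) \<Rightarrow> bool" where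
  "holder_ball \<beta> R C \<longleftrightarrow>
     (\<forall>s t. \<bar>C s t\<bar> \<le> R) \<and>
     (if \<beta> \<le> 1
      then \<forall>x y. \<bar>C (fst x) (snd x) - C (fst y) (snd y)\<bar> \<le> R * dist x y powr \<beta>
      else \<exists>G :: real \<times> real \<Rightarrow> real \<times> real.
             (\<forall>x. ((\<lambda>z. C (fst z) (snd z)) has_derivative (\<lambda>v. inner (G x) v)) (at x)) \<and>
             (\<forall>x. norm (G x) \<le> R) \<and>
             (\<forall>x y. norm (G x - G y) \<le> R * dist x y powr (\<beta> - 1)))"

definition conv :: "(real \<Rightarrow> real) \<Rightarrow> (real \<Rightarrow> real) \<Rightarrow> real \<Rightarrow> real" where
  "conv f g u = (LINT v|lborel. f v * g (u - v))"

definition c_kernel :: "(real \<Rightarrow> real) \<Rightarrow> real" where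
  "c_kernel K = (LINT u|lborel. (K u)\<^sup>2)\<^sup>2 / (LINT u|lborel. (conv K K u)\<^sup>2)"

definition admissible_kernel :: "(real \<Rightarrow> real) \<Rightarrow> bool" where
  "admissible_kernel K \<longleftrightarrow>
     (\<forall>u. K (- u) = K u) \<and> (\<exists>L. L-lipschitz_on UNIV K) \<and> (\<forall>u. \<bar>u\<bar> > 1 \<longrightarrow> K u = 0) \<and>
     (LINT u|lborel. K u) = 1"

definition scaled_kernel :: "(real \<Rightarrow> real) \<Rightarrow> real \<Rightarrow> real \<Rightarrow> real" where
  "scaled_kernel K h u = K (u / h) / h"

text \<open>
  One experiment: a sparse functional sample of \<open>nsub\<close> curves together with the (unprojected)
  smoother computed from it. The measurable space \<open>curves\<close> is the space in which the random
  curves take their values; subjects are numbered \<open>0, ..., nsub - 1\<close>, and \<open>intensity\<close> is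
  the mean number \<open>m\<close> of observations per curve.
\<close>

record 'w fda_experiment =
  prob :: "'w measure"
  curves :: "(real \<Rightarrow> real) measure"
  curve :: "nat \<Rightarrow> 'w \<Rightarrow> real \<Rightarrow> real"
  obs_time :: "nat \<Rightarrow> nat \<Rightarrow> 'w \<Rightarrow> real"
  noise :: "nat \<Rightarrow> nat \<Rightarrow> 'w \<Rightarrow> real"
  obs_count :: "nat \<Rightarrow> 'w \<Rightarrow> nat"
  nsub :: nat
  intensity :: real
  covar :: "real \<Rightarrow> real \<Rightarrow> real"
  design :: "real \<Rightarrow> real"
  noise_sd :: real
  cand_orders :: "nat list"
  grp :: enat
  bandwidth :: real
  smoother :: "'w \<Rightarrow> real \<Rightarrow> real \<Rightarrow> real"

definition obs :: "'w fda_experiment \<Rightarrow> nat \<Rightarrow> nat \<Rightarrow> 'w \<Rightarrow> real" where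
  "obs E i j \<omega> = curve E i \<omega> (obs_time E i j \<omega>) + noise E i j \<omega>"

text \<open>Normal with mean zero; the point mass at zero counts as normal.\<close>

definition centred_gaussian :: "'w measure \<Rightarrow> ('w \<Rightarrow> real) \<Rightarrow> bool" where
  "centred_gaussian M Z \<longleftrightarrow>
     Z \<in> borel_measurable M \<and>
     ((\<exists>s>0. distributed M lborel Z (normal_density 0 s)) \<or> (AE \<omega> in M. Z \<omega> = 0))"

text \<open>
  Joint measurability of the evaluation map on the curve space is what makes
  \<open>X\<^sub>i(T\<^sub>i\<^sub>j)\<close> a random variable whose law is determined by those of \<open>X\<^sub>i\<close> and \<open>T\<^sub>i\<^sub>j\<close>.
\<close>

definition gaussian_curves :: "'w fda_experiment \<Rightarrow> bool" where
  "gaussian_curves E \<longleftrightarrow>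
     (\<lambda>(x, t). x t) \<in> borel_measurable (curves E \<Otimes>\<^sub>M borel) \<and>
     (\<forall>x\<in>space (curves E). periodic_fun1 x \<and>
        set_integrable lborel {0..1} (\<lambda>t. (x t)\<^sup>2)) \<and>
     (\<forall>i<nsub E. curve E i \<in> prob E \<rightarrow>\<^sub>M curves E) \<and>
     (\<forall>i<nsub E. distr (prob E) (curves E) (curve E i) = distr (prob E) (curves E) (curve E 0)) \<and>
     (\<forall>i<nsub E. \<forall>\<phi>. \<phi> \<in> borel_measurable borel \<longrightarrow> set_integrable lborel {0..1} (\<lambda>t. (\<phi> t)\<^sup>2) \<longrightarrow>
        centred_gaussian (prob E) (\<lambda>\<omega>. LINT t:{0..1}|lborel. curve E i \<omega> t * \<phi> t)) \<and>
     (\<forall>i<nsub E. \<forall>t. integrable (prob E) (\<lambda>\<omega>. (curve E i \<omega> t)\<^sup>2) \<and>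
        (LINT \<omega>|prob E. curve E i \<omega> t) = 0) \<and>
     (\<forall>i<nsub E. \<forall>s t. (LINT \<omega>|prob E. curve E i \<omega> s * curve E i \<omega> t) = covar E s t)"

definition design_times :: "'w fda_experiment \<Rightarrow> bool" where
  "design_times E \<longleftrightarrow>
     design E \<in> borel_measurable borel \<and> periodic_fun1 (design E) \<and>
     (\<forall>i<nsub E. \<forall>j. distributed (prob E) lborel (obs_time E i j)
        (\<lambda>t. ennreal (design E t * indicator {0..<1} t)))"

definition noise_errors :: "'w fda_experiment \<Rightarrow> bool" where
  "noise_errors E \<longleftrightarrow>
     noise_sd E \<ge> 0 \<and>
     (\<forall>i<nsub E. \<forall>j. noise E i j \<in> borel_measurable (prob E) \<and>
        distr (prob E) borel (noise E i j) = distr (prob E) borel (noise E 0 0) \<and>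
        integrable (prob E) (\<lambda>\<omega>. (noise E i j \<omega>)\<^sup>2) \<and>
        (LINT \<omega>|prob E. noise E i j \<omega>) = 0 \<and>
        (LINT \<omega>|prob E. (noise E i j \<omega>)\<^sup>2) = (noise_sd E)\<^sup>2)"

definition random_counts :: "'w fda_experiment \<Rightarrow> bool" where
  "random_counts E \<longleftrightarrow>
     intensity E > 0 \<and>
     (\<forall>i<nsub E. obs_count E i \<in> prob E \<rightarrow>\<^sub>M count_space UNIV \<and>
        distr (prob E) (count_space UNIV) (obs_count E i)
          = distr (prob E) (count_space UNIV) (obs_count E 0) \<and>
        integrable (prob E) (\<lambda>\<omega>. real (obs_count E i \<omega>) ^ 4) \<and>
        (LINT \<omega>|prob E. real (obs_count E i \<omega>)) = intensity E)"

datatype source = Curve nat | Time nat nat | Noise nat nat | Count nat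

primrec subject :: "source \<Rightarrow> nat" where
  "subject (Curve i) = i"
| "subject (Time i j) = i"
| "subject (Noise i j) = i"
| "subject (Count i) = i"

primrec source_events :: "'w fda_experiment \<Rightarrow> source \<Rightarrow> 'w set set" where
  "source_events E (Curve i) = sets (vimage_algebra (space (prob E)) (curve E i) (curves E))"
| "source_events E (Time i j) = sets (vimage_algebra (space (prob E)) (obs_time E i j) borel)"
| "source_events E (Noise i j) = sets (vimage_algebra (space (prob E)) (noise E i j) borel)"
| "source_events E (Count i) =
     sets (vimage_algebra (space (prob E)) (obs_count E i) (count_space UNIV))"

text \<open>
  Mutual independence of all sources of randomness gives both the independence inside each
  family and the independence of the families; the counts are independent of the rest.
\<close>

definition independent_sources :: "'w fda_experiment \<Rightarrow> bool" where
  "independent_sources E \<longleftrightarrow>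
     prob_space.indep_sets (prob E) (source_events E) {v. subject v < nsub E}"

definition order_chain :: "nat list \<Rightarrow> bool" where
  "order_chain qs \<longleftrightarrow> qs \<noteq> [] \<and> hd qs = 1 \<and> sorted_wrt (\<lambda>a b. a < b \<and> a dvd b) qs"

text \<open>Bivariate polynomials of total degree at most \<open>d\<close>, given by their coefficients.\<close>

definition poly2 :: "nat \<Rightarrow> (nat \<Rightarrow> nat \<Rightarrow> real) \<Rightarrow> real \<Rightarrow> real \<Rightarrow> real" where
  "poly2 d p x y = (\<Sum>a\<le>d. \<Sum>b\<le>d - a. p a b * x ^ a * y ^ b)"

definition local_loss ::
    "(real \<Rightarrow> real) \<Rightarrow> nat \<Rightarrow> 'w fda_experiment \<Rightarrow> 'w \<Rightarrow> real \<Rightarrow> real \<Rightarrow> (nat \<Rightarrow> nat \<Rightarrow> real) \<Rightarrow> real" where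
  "local_loss K d E \<omega> s t p =
     (\<Sum>i<nsub E. \<Sum>j<obs_count E i \<omega>. \<Sum>k\<in>{..<obs_count E i \<omega>} - {j}.
        (obs E i j \<omega> * obs E i k \<omega>
           - poly2 d p (circ (obs_time E i j \<omega> - s)) (circ (obs_time E i k \<omega> - t)))\<^sup>2
        * scaled_kernel K (bandwidth E) (circ (obs_time E i j \<omega> - s))
        * scaled_kernel K (bandwidth E) (circ (obs_time E i k \<omega> - t)))"

text \<open>
  The minimiser need not be unique (for instance when no design point falls into the window);
  the smoother is then any measurable choice among the minimisers.
\<close>

definition local_polynomial_smoother :: "(real \<Rightarrow> real) \<Rightarrow> nat \<Rightarrow> 'w fda_experiment \<Rightarrow> bool" where
  "local_polynomial_smoother K d E \<longleftrightarrow>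
     (\<lambda>(\<omega>, s, t). smoother E \<omega> s t) \<in> borel_measurable (prob E \<Otimes>\<^sub>M borel \<Otimes>\<^sub>M borel) \<and>
     (\<forall>\<omega>\<in>space (prob E). periodic_fun2 (smoother E \<omega>)) \<and>
     (\<forall>\<omega>\<in>space (prob E). \<forall>s t. \<exists>p.
        (\<forall>p'. local_loss K d E \<omega> s t p \<le> local_loss K d E \<omega> s t p') \<and> smoother E \<omega> s t = p 0 0)"

definition sparse_functional_model :: "(real \<Rightarrow> real) \<Rightarrow> real \<Rightarrow> 'w fda_experiment \<Rightarrow> bool" where
  "sparse_functional_model K \<beta> E \<longleftrightarrow>
     prob_space (prob E) \<and> nsub E \<ge> 1 \<and>
     gaussian_curves E \<and> design_times E \<and> noise_errors E \<and> random_counts E \<and>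
     independent_sources E \<and>
     order_chain (cand_orders E) \<and> grp E \<in> insert \<infinity> (enat ` set (cand_orders E)) \<and>
     local_polynomial_smoother K (nat \<lfloor>\<beta>\<rfloor>) E"

definition Lp_bounded :: "'w measure \<Rightarrow> real \<Rightarrow> ('w \<Rightarrow> real) \<Rightarrow> bool" where
  "Lp_bounded M K0 Z \<longleftrightarrow>
     (\<forall>p\<ge>1. integrable M (\<lambda>\<omega>. \<bar>Z \<omega>\<bar> powr p) \<and>
        (LINT \<omega>|M. \<bar>Z \<omega>\<bar> powr p) powr (1 / p) \<le> K0 * sqrt p)"

definition same_order_on :: "'i set \<Rightarrow> ('i \<Rightarrow> real) \<Rightarrow> ('i \<Rightarrow> real) \<Rightarrow> bool" where
  "same_order_on S f g \<longleftrightarrow> (\<exists>c1>0. \<exists>c2>0. \<forall>x\<in>S. c1 * g x \<le> f x \<and> f x \<le> c2 * g x)"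

text \<open>Integrated squared error of the projected smoother, possibly infinite.\<close>

definition risk :: "'w fda_experiment \<Rightarrow> ennreal" where
  "risk E =
     (\<integral>\<^sup>+\<omega>. (\<integral>\<^sup>+s\<in>{0..1}. (\<integral>\<^sup>+t\<in>{0..1}.
        ennreal ((rot_proj (grp E) (smoother E \<omega>) s t - covar E s t)\<^sup>2) \<partial>lborel) \<partial>lborel) \<partial>prob E)"

definition q_sharp :: "(real \<Rightarrow> real) \<Rightarrow> real \<Rightarrow> nat \<Rightarrow> real \<Rightarrow> real" where
  "q_sharp K \<beta> n m =
     c_kernel K powr ((2 * \<beta> + 2) / (2 * \<beta> + 1)) * (real n * m\<^sup>2) powr (1 / (2 * \<beta> + 1))"

text \<open>
  First terms of the rates. The order is an extended real, so that it covers the group orders,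
  the full circle group \<open>\<infinity>\<close>, and the value \<open>q_sharp\<close>, which need not be an integer; the two
  branches agree at \<open>q_sharp\<close>.
\<close>

definition saturated_term :: "(real \<Rightarrow> real) \<Rightarrow> real \<Rightarrow> nat \<Rightarrow> real \<Rightarrow> real" where
  "saturated_term K \<beta> n m = (c_kernel K * real n * m\<^sup>2) powr (- (2 * \<beta>) / (2 * \<beta> + 1))"

definition leading_term :: "(real \<Rightarrow> real) \<Rightarrow> real \<Rightarrow> nat \<Rightarrow> real \<Rightarrow> ereal \<Rightarrow> real" where
  "leading_term K \<beta> n m q =
     (if q \<le> ereal (q_sharp K \<beta> n m)
      then (real n * m\<^sup>2 * real_of_ereal q) powr (- \<beta> / (\<beta> + 1))
      else saturated_term K \<beta> n m)"

definition rate :: "(real \<Rightarrow> real) \<Rightarrow> real \<Rightarrow> nat \<Rightarrow> real \<Rightarrow> ereal \<Rightarrow> real" where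
  "rate K \<beta> n m q = leading_term K \<beta> n m q + 1 / real n"

definition exp_q_sharp :: "(real \<Rightarrow> real) \<Rightarrow> real \<Rightarrow> 'w fda_experiment \<Rightarrow> real" where
  "exp_q_sharp K \<beta> E = q_sharp K \<beta> (nsub E) (intensity E)"

definition exp_rate :: "(real \<Rightarrow> real) \<Rightarrow> real \<Rightarrow> 'w fda_experiment \<Rightarrow> real" where
  "exp_rate K \<beta> E = rate K \<beta> (nsub E) (intensity E) (ereal_of_enat (grp E))"

definition rate_optimal_bandwidths :: "(real \<Rightarrow> real) \<Rightarrow> real \<Rightarrow> 'w fda_experiment set \<Rightarrow> bool" where
  "rate_optimal_bandwidths K \<beta> \<E> \<longleftrightarrow>
     same_order_on {E \<in> \<E>. ereal_of_enat (grp E) \<le> ereal (exp_q_sharp K \<beta> E)} bandwidth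
       (\<lambda>E. (real (nsub E) * (intensity E)\<^sup>2 * real_of_ereal (ereal_of_enat (grp E)))
              powr (- 1 / (2 * \<beta> + 2))) \<and>
     same_order_on {E \<in> \<E>. ereal_of_enat (grp E) \<ge> ereal (exp_q_sharp K \<beta> E)} bandwidth
       (\<lambda>E. (c_kernel K * real (nsub E) * (intensity E)\<^sup>2) powr (- 1 / (2 * \<beta> + 1)))"

definition risk_has_order :: "(real \<Rightarrow> real) \<Rightarrow> real \<Rightarrow> 'w fda_experiment set \<Rightarrow> bool" where
  "risk_has_order K \<beta> \<E> \<longleftrightarrow>
     (\<exists>c1>0. \<exists>c2>0. \<forall>E\<in>\<E>.
        ennreal (c1 * exp_rate K \<beta> E) \<le> risk E \<and> risk E \<le> ennreal (c2 * exp_rate K \<beta> E))"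

text \<open>Sampling intensity at which a term \<open>r m\<close> of the rate equals \<open>1/n\<close>.\<close>

definition is_threshold :: "nat \<Rightarrow> (real \<Rightarrow> real) \<Rightarrow> real \<Rightarrow> bool" where
  "is_threshold n r m \<longleftrightarrow> m > 0 \<and> r m = 1 / real n"

definition m_star :: "(real \<Rightarrow> real) \<Rightarrow> real \<Rightarrow> nat \<Rightarrow> real" where
  "m_star K \<beta> n = (THE m. is_threshold n (saturated_term K \<beta> n) m)"

definition m_threshold :: "(real \<Rightarrow> real) \<Rightarrow> real \<Rightarrow> nat \<Rightarrow> ereal \<Rightarrow> real" where
  "m_threshold K \<beta> n q = (THE m. is_threshold n (\<lambda>m. leading_term K \<beta> n m q) m)"

end

theory Submission
  imports Defs
begin

text \<open>
  For a finite order the leading term of the rate is the maximum of the saturated term and of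
  \<open>(n m\<^sup>2 q) powr (- \<beta> / (\<beta> + 1))\<close>, the two crossing exactly at \<open>q\<^sup>\<sharp>\<close>; for the circle group it
  is the saturated term. Both terms decrease in \<open>m\<close>, so the threshold is the maximum of the two
  thresholds, hence at least the saturated one, for which the defining equation can be solved
  explicitly. The constant \<open>c\<^sub>K\<close> is positive because \<open>K\<close> and \<open>K \<star> K\<close> are continuous with compact
  support and \<open>(K \<star> K) 0 = \<integral>K\<^sup>2 > 0\<close>.
\<close>

section \<open>Positivity of the kernel constant\<close>

lemma integrable_continuous_compact_support:
  fixes f :: "real \<Rightarrow> real"
  assumes "continuous_on UNIV f" and "\<And>x. \<bar>x\<bar> > r \<Longrightarrow> f x = 0"
  shows "integrable lborel f"
proof -
  have "set_integrable lborel {-r..r} f"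
    by (rule borel_integrable_atLeastAtMost') (use assms(1) continuous_on_subset in blast)
  moreover have "(\<lambda>x. indicator {-r..r} x *\<^sub>R f x) = f"
    using assms(2) by (auto simp: fun_eq_iff indicator_def abs_le_iff not_le)
      (metis abs_le_iff linorder_not_le minus_le_iff)+
  ultimately show ?thesis
    by (simp add: set_integrable_def)
qed

text \<open>By continuity \<open>f\<close> stays above \<open>f x0 / 2\<close> on an interval of
  radius \<open>d\<close> around \<open>x0\<close>, so its integral dominates that of a box of
  height \<open>f x0 / 2\<close> and width \<open>2 * d\<close>.\<close>

lemma integral_pos_continuous:
  fixes f :: "real \<Rightarrow> real"
  assumes cont: "continuous_on UNIV f" and int: "integrable lborel f"
    and nonneg: "\<And>x. f x \<ge> 0" and pos: "f x0 > 0"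
  shows "(LINT x|lborel. f x) > 0"
proof -
  have "isCont f x0"
    using cont by (simp add: continuous_on_eq_continuous_at)
  then obtain d where d: "d > 0" "\<And>x. \<bar>x - x0\<bar> < d \<Longrightarrow> \<bar>f x - f x0\<bar> < f x0 / 2"
    using pos unfolding continuous_at_eps_delta dist_real_def
    by (metis half_gt_zero)
  let ?g = "\<lambda>x. f x0 / 2 * indicator {x0 - d<..<x0 + d} x"
  have "0 < f x0 / 2 * (2 * d)"
    using pos d(1) by simp
  also have "\<dots> = (LINT x|lborel. ?g x)"
    using d(1) by simp
  also have "\<dots> \<le> (LINT x|lborel. f x)"
  proof (rule integral_mono[OF _ int])
    show "integrable lborel ?g"
      by (intro integrable_mult_right integrable_real_indicator) (use d(1) in auto)
    show "?g x \<le> f x" for x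
    proof (cases "x \<in> {x0 - d<..<x0 + d}")
      case True
      then have "\<bar>f x - f x0\<bar> < f x0 / 2"
        by (intro d(2)) auto
      then have "f x0 / 2 \<le> f x"
        by linarith
      then show ?thesis
        using True by simp
    qed (simp add: nonneg)
  qed
  finally show ?thesis .
qed

lemma c_kernel_pos:
  assumes K: "admissible_kernel K"
  shows "c_kernel K > 0"
proof -
  obtain L where L: "L-lipschitz_on UNIV K" and sym: "\<And>u. K (- u) = K u"
    and supp: "\<And>u. \<bar>u\<bar> > 1 \<Longrightarrow> K u = 0" and one: "(LINT u|lborel. K u) = 1"
    using K unfolding admissible_kernel_def by blast
  have cont: "continuous_on UNIV K"
    using L by (rule lipschitz_on_continuous_on)
  have shift: "continuous_on UNIV (\<lambda>v. K (u - v))" for u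
    using continuous_on_compose2[OF cont, of UNIV "\<lambda>v. u - v"] by (simp add: continuous_intros)
  have int_K: "integrable lborel K"
    using cont supp by (rule integrable_continuous_compact_support)
  have int_prod: "integrable lborel (\<lambda>v. K v * K (u - v))" for u
    using cont shift supp
    by (intro integrable_continuous_compact_support[where r = 1] continuous_intros) auto
  obtain x0 where "K x0 \<noteq> 0"
    using one by fastforce
  then have sq_pos: "(LINT u|lborel. (K u)\<^sup>2) > 0"
    using cont supp
    by (intro integral_pos_continuous[of _ x0] integrable_continuous_compact_support[where r = 1]
        continuous_intros) auto
  \<comment> \<open>The Lipschitz bound of \<open>K\<close> passes under the integral, at the price
    of the L1 norm of \<open>K\<close> as a factor; this yields the continuity of
    \<open>conv K K\<close>.\<close>
  have lip: "\<bar>conv K K u - conv K K w\<bar> \<le> (LINT v|lborel. \<bar>K v\<bar>) * L * \<bar>u - w\<bar>" for u w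
  proof -
    have "conv K K u - conv K K w = (LINT v|lborel. K v * K (u - v) - K v * K (w - v))"
      using int_prod by (simp add: conv_def)
    also have "\<bar>\<dots>\<bar> \<le> (LINT v|lborel. \<bar>K v * K (u - v) - K v * K (w - v)\<bar>)"
      by (rule integral_abs_bound)
    also have "\<dots> \<le> (LINT v|lborel. \<bar>K v\<bar> * (L * \<bar>u - w\<bar>))"
    proof (rule integral_mono)
      show "integrable lborel (\<lambda>v. \<bar>K v * K (u - v) - K v * K (w - v)\<bar>)"
        using int_prod by (intro integrable_abs Bochner_Integration.integrable_diff)
      show "integrable lborel (\<lambda>v. \<bar>K v\<bar> * (L * \<bar>u - w\<bar>))"
        using int_K by (intro integrable_mult_left integrable_abs)
      show "\<bar>K v * K (u - v) - K v * K (w - v)\<bar> \<le> \<bar>K v\<bar> * (L * \<bar>u - w\<bar>)" for v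
        using lipschitz_onD[OF L, of "u - v" "w - v"]
        by (simp add: dist_real_def abs_mult mult_left_mono flip: right_diff_distrib)
    qed
    finally show ?thesis
      by (simp add: mult.assoc)
  qed
  have "0 \<le> L"
    using L by (rule lipschitz_on_nonneg)
  then have "((LINT v|lborel. \<bar>K v\<bar>) * L)-lipschitz_on UNIV (conv K K)"
    using lip by (intro lipschitz_onI) (auto simp: dist_real_def)
  then have cont_conv: "continuous_on UNIV (conv K K)"
    by (rule lipschitz_on_continuous_on)
  have "conv K K u = 0" if "\<bar>u\<bar> > 2" for u
  proof -
    \<comment> \<open>The points \<open>v\<close> and \<open>u - v\<close> cannot both lie in
      [-1, 1] when their sum exceeds 2 in absolute value.\<close>
    have zero: "K v * K (u - v) = 0" for v
      using supp[of v] supp[of "u - v"] that by (cases "\<bar>v\<bar> > 1") auto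
    then show ?thesis
      by (simp only: conv_def zero integral_zero)
  qed
  \<comment> \<open>Symmetry turns the integrand \<open>K v * K (0 - v)\<close> into a
    square.\<close>
  moreover have "conv K K 0 > 0"
    using sq_pos by (simp add: conv_def sym power2_eq_square)
  ultimately have "(LINT u|lborel. (conv K K u)\<^sup>2) > 0"
    using cont_conv
    by (intro integral_pos_continuous[of _ 0] integrable_continuous_compact_support[where r = 2]
        continuous_intros) auto
  then show ?thesis
    using sq_pos by (simp add: c_kernel_def)
qed

section \<open>Power laws in the sampling intensity and the saturated threshold\<close>

text \<open>Logarithms make both inequalities linear in \<open>ln m\<close>. Two one-sided
  equivalences are kept instead of a solved equation because they pass through a maximum of two
  terms and also serve one-sided bounds on the risk.\<close>

lemma powr_le_iff_threshold:
  fixes m y k \<alpha> :: real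
  assumes "m > 0" "y > 0" "k > 0" "\<alpha> > 0"
  shows "(k * m\<^sup>2) powr (- \<alpha>) \<le> 1 / y \<longleftrightarrow> (y powr (1 / \<alpha>) / k) powr (1 / 2) \<le> m"
    and "1 / y \<le> (k * m\<^sup>2) powr (- \<alpha>) \<longleftrightarrow> m \<le> (y powr (1 / \<alpha>) / k) powr (1 / 2)"
proof -
  have lns: "ln ((k * m\<^sup>2) powr (- \<alpha>)) = - \<alpha> * (ln k + 2 * ln m)" "ln (1 / y) = - ln y"
    "ln ((y powr (1 / \<alpha>) / k) powr (1 / 2)) = (ln y / \<alpha> - ln k) / 2"
    using assms by (simp_all add: ln_powr ln_mult ln_div ln_realpow)
  have "(k * m\<^sup>2) powr (- \<alpha>) \<le> 1 / y \<longleftrightarrow> ln ((k * m\<^sup>2) powr (- \<alpha>)) \<le> ln (1 / y)"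
    "1 / y \<le> (k * m\<^sup>2) powr (- \<alpha>) \<longleftrightarrow> ln (1 / y) \<le> ln ((k * m\<^sup>2) powr (- \<alpha>))"
    "(y powr (1 / \<alpha>) / k) powr (1 / 2) \<le> m \<longleftrightarrow> ln ((y powr (1 / \<alpha>) / k) powr (1 / 2)) \<le> ln m"
    "m \<le> (y powr (1 / \<alpha>) / k) powr (1 / 2) \<longleftrightarrow> ln m \<le> ln ((y powr (1 / \<alpha>) / k) powr (1 / 2))"
    using assms by (intro ln_le_cancel_iff[symmetric]; simp)+
  moreover have "(- \<alpha> * (ln k + 2 * ln m) \<le> - ln y) = ((ln y / \<alpha> - ln k) / 2 \<le> ln m)"
    "(- ln y \<le> - \<alpha> * (ln k + 2 * ln m)) = (ln m \<le> (ln y / \<alpha> - ln k) / 2)"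
    using assms by (auto simp: field_simps)
  ultimately show "(k * m\<^sup>2) powr (- \<alpha>) \<le> 1 / y \<longleftrightarrow> (y powr (1 / \<alpha>) / k) powr (1 / 2) \<le> m"
    and "1 / y \<le> (k * m\<^sup>2) powr (- \<alpha>) \<longleftrightarrow> m \<le> (y powr (1 / \<alpha>) / k) powr (1 / 2)"
    unfolding lns by simp_all
qed

text \<open>The factor \<open>B\<close> allows two uses: \<open>B = 1\<close> gives the threshold
  itself, and another value absorbs the constants of a risk bound.\<close>

lemma saturated_term_threshold:
  assumes c: "c_kernel K > 0" and beta: "\<beta> > 0" and n: "n \<ge> 1" and m: "m > 0" and B: "B > 0"
  defines "M \<equiv> (B powr ((2 * \<beta> + 1) / (2 * \<beta>)) / c_kernel K) powr (1 / 2)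
                 * real n powr (1 / (4 * \<beta>))"
  shows "saturated_term K \<beta> n m \<le> 1 / (B * real n) \<longleftrightarrow> M \<le> m"
    and "1 / (B * real n) \<le> saturated_term K \<beta> n m \<longleftrightarrow> m \<le> M"
proof -
  let ?\<alpha> = "2 * \<beta> / (2 * \<beta> + 1)"
  have "1 / ?\<alpha> = (2 * \<beta> + 1) / (2 * \<beta>)"
    by simp
  \<comment> \<open>Splitting off exponent 1 cancels the factor \<open>real n\<close> next to
    \<open>c_kernel K\<close>; the square root of the remaining power of \<open>n\<close> has
    exponent \<open>1 / (4 * \<beta>)\<close>.\<close>
  moreover have "(2 * \<beta> + 1) / (2 * \<beta>) = 1 / (2 * \<beta>) + 1"
    using beta by (simp add: field_simps)
  then have "real n powr ((2 * \<beta> + 1) / (2 * \<beta>)) = real n powr (1 / (2 * \<beta>)) * real n"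
    using n by (simp add: powr_add)
  ultimately have "(B * real n) powr (1 / ?\<alpha>) / (c_kernel K * real n)
      = B powr ((2 * \<beta> + 1) / (2 * \<beta>)) / c_kernel K * real n powr (1 / (2 * \<beta>))"
    using n B by (simp add: powr_mult)
  then have M: "((B * real n) powr (1 / ?\<alpha>) / (c_kernel K * real n)) powr (1 / 2) = M"
    unfolding M_def by (simp only: powr_mult powr_powr) simp
  have sat: "saturated_term K \<beta> n m = (c_kernel K * real n * m\<^sup>2) powr (- ?\<alpha>)"
    by (simp add: saturated_term_def)
  have pos: "m > 0" "B * real n > 0" "c_kernel K * real n > 0" "?\<alpha> > 0"
    using c beta n m B by simp_all
  show "saturated_term K \<beta> n m \<le> 1 / (B * real n) \<longleftrightarrow> M \<le> m"
    and "1 / (B * real n) \<le> saturated_term K \<beta> n m \<longleftrightarrow> m \<le> M"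
    using powr_le_iff_threshold[OF pos] unfolding M sat by blast+
qed

lemma is_threshold_saturated_iff:
  assumes "c_kernel K > 0" and "\<beta> > 0" and "n \<ge> 1"
  shows "is_threshold n (saturated_term K \<beta> n) m \<longleftrightarrow>
    m = c_kernel K powr (- 1 / 2) * real n powr (1 / (4 * \<beta>))"
proof -
  have "(1 / c_kernel K) powr (1 / 2) = c_kernel K powr (- 1 / 2)"
    using assms by (simp add: powr_divide powr_minus_divide)
  \<comment> \<open>Positivity of the closed form settles the case \<open>m \<le> 0\<close>, where
    both sides of the equivalence fail.\<close>
  moreover have "c_kernel K powr (- 1 / 2) * real n powr (1 / (4 * \<beta>)) > 0"
    using assms by simp
  ultimately show ?thesis
    using saturated_term_threshold[OF assms, of m 1] unfolding is_threshold_def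
    by (cases "m > 0") (simp_all, fastforce+)
qed

lemma m_star_eq:
  assumes "c_kernel K > 0" and "\<beta> > 0" and "n \<ge> 1"
  shows "m_star K \<beta> n = c_kernel K powr (- 1 / 2) * real n powr (1 / (4 * \<beta>))"
  using is_threshold_saturated_iff[OF assms] by (simp add: m_star_def)

section \<open>The leading term as a maximum\<close>

lemma q_sharp_pos: "c_kernel K > 0 \<Longrightarrow> n \<ge> 1 \<Longrightarrow> m > 0 \<Longrightarrow> q_sharp K \<beta> n m > 0"
  by (simp add: q_sharp_def)

lemma leading_term_eq_max:
  assumes c: "c_kernel K > 0" and beta: "\<beta> > 0" and n: "n \<ge> 1" and m: "m > 0" and q: "q > 0"
  shows "leading_term K \<beta> n m (ereal q) =
    max (saturated_term K \<beta> n m) ((real n * q * m\<^sup>2) powr (- (\<beta> / (\<beta> + 1))))"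
proof -
  define x where "x = real n * m\<^sup>2"
  have x: "x > 0"
    using n m by (simp add: x_def)
  let ?f = "(x * q) powr (- (\<beta> / (\<beta> + 1)))"
  have sat: "saturated_term K \<beta> n m = (c_kernel K * x) powr (- (2 * \<beta> / (2 * \<beta> + 1)))"
    by (simp add: saturated_term_def x_def mult.assoc)
  have pos: "2 * \<beta> + 1 > 0" "\<beta> + 1 > 0"
    using beta by simp_all
  \<comment> \<open>The branch condition is rewritten, through logarithms, as the comparison of the
    two terms; hence the definition always selects the larger one.\<close>
  have "q \<le> q_sharp K \<beta> n m \<longleftrightarrow> ln q \<le> ln (q_sharp K \<beta> n m)"
    using q q_sharp_pos[OF c n m] by simp
  also have "ln (q_sharp K \<beta> n m)
      = (2 * \<beta> + 2) / (2 * \<beta> + 1) * ln (c_kernel K) + 1 / (2 * \<beta> + 1) * ln x"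
    using c x by (simp add: q_sharp_def x_def[symmetric] ln_mult ln_powr)
  also have "\<dots> = ((2 * \<beta> + 2) * ln (c_kernel K) + ln x) / (2 * \<beta> + 1)"
    by (simp add: add_divide_distrib[of _ "ln x"])
  \<comment> \<open>After clearing the denominator, \<open>(2 * \<beta> + 1) * ln x\<close> is added
    to both sides, so that \<open>ln x\<close> pairs with \<open>ln q\<close> and with
    \<open>ln (c_kernel K)\<close>.\<close>
  also have "ln q \<le> \<dots> \<longleftrightarrow>
      (2 * \<beta> + 1) * (ln x + ln q) \<le> (2 * \<beta> + 2) * (ln (c_kernel K) + ln x)"
    using pos by (simp add: pos_le_divide_eq algebra_simps)
  also have "\<dots> \<longleftrightarrow> \<beta> * ((2 * \<beta> + 1) * (ln x + ln q))
      \<le> \<beta> * ((2 * \<beta> + 2) * (ln (c_kernel K) + ln x))"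
    using beta by simp
  \<comment> \<open>Division by the negative number
    \<open>- (2 * \<beta> + 1) * (\<beta> + 1)\<close> exchanges the sides and produces the two rate
    exponents.\<close>
  also have "\<dots> \<longleftrightarrow> - (2 * \<beta> / (2 * \<beta> + 1)) * (ln (c_kernel K) + ln x)
      \<le> - (\<beta> / (\<beta> + 1)) * (ln x + ln q)"
    using pos by (simp add: field_simps)
  also have "\<dots> \<longleftrightarrow> ln (saturated_term K \<beta> n m) \<le> ln ?f"
    using c x q by (simp add: sat ln_powr ln_mult)
  also have "\<dots> \<longleftrightarrow> saturated_term K \<beta> n m \<le> ?f"
    using c x q by (intro ln_le_cancel_iff) (simp_all add: sat)
  finally have "q \<le> q_sharp K \<beta> n m \<longleftrightarrow> saturated_term K \<beta> n m \<le> ?f" .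
  moreover have eq: "real n * q * m\<^sup>2 = x * q"
    by (simp add: x_def)
  ultimately show ?thesis
    unfolding eq by (simp add: leading_term_def max_def flip: x_def)
qed

lemma saturated_term_le_leading_term:
  assumes "c_kernel K > 0" and "\<beta> > 0" and "n \<ge> 1" and "m > 0" and "q > 0"
  shows "saturated_term K \<beta> n m \<le> leading_term K \<beta> n m q"
  using assms leading_term_eq_max[OF assms(1-4)] by (cases q) (auto simp: leading_term_def)

section \<open>Thresholds of the leading term\<close>

text \<open>A single witness carries existence, uniqueness and the lower bound, so that the definite
  description in \<open>m_threshold\<close> can be evaluated afterwards.\<close>

lemma ex_leading_threshold:
  assumes c: "c_kernel K > 0" and beta: "\<beta> > 0" and n: "n \<ge> 1" and q: "q > 0"
  shows "\<exists>m0 \<ge> m_star K \<beta> n. \<forall>m. is_threshold n (\<lambda>m. leading_term K \<beta> n m q) m \<longleftrightarrow> m = m0"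
proof (cases q)
  case (real r)
  then have r: "r > 0"
    using q by simp
  define M where "M = m_star K \<beta> n"
  \<comment> \<open>\<open>M'\<close> is the intensity at which the unsaturated term of order
    \<open>r\<close> equals \<open>1 / n\<close>.\<close>
  define M' where "M' = (real n powr (1 / (\<beta> / (\<beta> + 1))) / (real n * r)) powr (1 / 2)"
  have M_pos: "M > 0"
    using c n by (simp add: M_def m_star_eq[OF c beta n])
  have "(1 / c_kernel K) powr (1 / 2) = c_kernel K powr (- 1 / 2)"
    using c by (simp add: powr_divide powr_minus_divide)
  then have sat: "saturated_term K \<beta> n m \<le> 1 / real n \<longleftrightarrow> M \<le> m"
      "1 / real n \<le> saturated_term K \<beta> n m \<longleftrightarrow> m \<le> M" if "m > 0" for m
    using saturated_term_threshold[OF c beta n that, of 1]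
    by (simp_all add: M_def m_star_eq[OF c beta n])
  have other: "(real n * r * m\<^sup>2) powr (- (\<beta> / (\<beta> + 1))) \<le> 1 / real n \<longleftrightarrow> M' \<le> m"
      "1 / real n \<le> (real n * r * m\<^sup>2) powr (- (\<beta> / (\<beta> + 1))) \<longleftrightarrow> m \<le> M'"
    if "m > 0" for m
    unfolding M'_def using that n r beta by (intro powr_le_iff_threshold; simp)+
  have "is_threshold n (\<lambda>m. leading_term K \<beta> n m q) m \<longleftrightarrow> m = max M M'" for m
  proof (cases "m > 0")
    case True
    have "leading_term K \<beta> n m q = 1 / real n \<longleftrightarrow>
        leading_term K \<beta> n m q \<le> 1 / real n \<and> 1 / real n \<le> leading_term K \<beta> n m q"
      by auto
    \<comment> \<open>A maximum is at most \<open>1 / n\<close> iff both terms are, and at least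
      \<open>1 / n\<close> iff one of them is; this matches the two bounds by
      \<open>max M M'\<close>.\<close>
    also have "\<dots> \<longleftrightarrow> max M M' \<le> m \<and> m \<le> max M M'"
      unfolding real leading_term_eq_max[OF c beta n True r] le_max_iff_disj max.bounded_iff
        sat[OF True] other[OF True] ..
    finally show ?thesis
      using True by (auto simp: is_threshold_def)
  next
    case False
    then show ?thesis
      using M_pos by (auto simp: is_threshold_def)
  qed
  then show ?thesis
    unfolding M_def by (intro exI[of _ "max (m_star K \<beta> n) M'"]) simp
next
  case PInf
  \<comment> \<open>Infinity exceeds the real number \<open>q_sharp\<close>, so the saturated branch
    applies at every \<open>m\<close>.\<close>
  then have "is_threshold n (\<lambda>m. leading_term K \<beta> n m q) m \<longleftrightarrow> m = m_star K \<beta> n" for m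
    using is_threshold_saturated_iff[OF c beta n, of m]
    by (simp add: is_threshold_def leading_term_def m_star_eq[OF c beta n])
  then show ?thesis
    by blast
next
  case MInf
  then show ?thesis
    using q by simp
qed

lemma is_threshold_leading_iff:
  assumes "c_kernel K > 0" and "\<beta> > 0" and "n \<ge> 1" and "q > 0"
  shows "is_threshold n (\<lambda>m. leading_term K \<beta> n m q) m \<longleftrightarrow> m = m_threshold K \<beta> n q"
    and "m_star K \<beta> n \<le> m_threshold K \<beta> n q"
proof -
  obtain m0 where m0: "m0 \<ge> m_star K \<beta> n"
    "\<And>m. is_threshold n (\<lambda>m. leading_term K \<beta> n m q) m \<longleftrightarrow> m = m0"
    using ex_leading_threshold[OF assms] by blast
  then have "m_threshold K \<beta> n q = m0"
    by (simp add: m_threshold_def)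
  then show "is_threshold n (\<lambda>m. leading_term K \<beta> n m q) m \<longleftrightarrow> m = m_threshold K \<beta> n q"
    and "m_star K \<beta> n \<le> m_threshold K \<beta> n q"
    using m0 by simp_all
qed

text \<open>The order is frozen at its value for \<open>m_star\<close>. At that intensity the two
  branches agree, so \<open>m_star\<close> solves the threshold equation of this order, and
  uniqueness identifies it.\<close>

lemma m_threshold_q_sharp:
  assumes c: "c_kernel K > 0" and beta: "\<beta> > 0" and n: "n \<ge> 1"
  shows "m_threshold K \<beta> n (ereal (q_sharp K \<beta> n (m_star K \<beta> n))) = m_star K \<beta> n"
proof -
  let ?m = "m_star K \<beta> n"
  let ?q = "q_sharp K \<beta> n ?m"
  have m: "is_threshold n (saturated_term K \<beta> n) ?m"
    using is_threshold_saturated_iff[OF assms] m_star_eq[OF assms] by simp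
  then have m_pos: "?m > 0"
    by (simp add: is_threshold_def)
  define x where "x = real n * ?m\<^sup>2"
  have x: "x > 0"
    using n m_pos by (simp add: x_def)
  let ?e = "(2 * \<beta> + 2) / (2 * \<beta> + 1)"
  \<comment> \<open>In \<open>q_sharp\<close> the exponent of \<open>x\<close> is one less than that
    of \<open>c_kernel K\<close>; multiplying by \<open>x\<close> therefore gives a pure power of
    \<open>c_kernel K * x\<close>.\<close>
  have "1 / (2 * \<beta> + 1) = ?e - 1"
    using beta by (simp add: field_simps)
  then have "x * ?q = (c_kernel K * x) powr ?e"
    using c x by (simp add: q_sharp_def powr_mult powr_diff flip: x_def)
  moreover have "?e * (- \<beta> / (\<beta> + 1)) = - (2 * \<beta>) / (2 * \<beta> + 1)"
    using beta by (simp add: divide_simps)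
  ultimately have "(x * ?q) powr (- \<beta> / (\<beta> + 1)) = (c_kernel K * x) powr (- (2 * \<beta>) / (2 * \<beta> + 1))"
    by (simp only: powr_powr)
  then have "leading_term K \<beta> n ?m (ereal ?q) = saturated_term K \<beta> n ?m"
    by (simp add: leading_term_def saturated_term_def x_def mult.assoc)
  then have "is_threshold n (\<lambda>m. leading_term K \<beta> n m (ereal ?q)) ?m"
    using m by (simp add: is_threshold_def)
  moreover have "ereal ?q > 0"
    using q_sharp_pos[OF c n m_pos] by simp
  ultimately show ?thesis
    using is_threshold_leading_iff(1)[OF assms] by metis
qed

section \<open>From the rate to the risk of the experiments\<close>

lemma grp_pos:
  assumes "sparse_functional_model K \<beta> E"
  shows "ereal_of_enat (grp E) > 0"
proof -
  \<comment> \<open>The chain starts at 1 and increases strictly.\<close>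
  have "q > 0" if "q \<in> set (cand_orders E)" for q
    using assms that unfolding sparse_functional_model_def order_chain_def
    by (cases "cand_orders E") auto
  then show ?thesis
    using assms unfolding sparse_functional_model_def by (auto simp: zero_enat_def)
qed

text \<open>The threshold bound in terms of the actual risk: the risk dominates \<open>c1\<close>
  times the saturated term whatever the group, so a risk of parametric order \<open>A / n\<close>
  forces that term below a multiple of \<open>1 / n\<close>. The constant is uniform over the
  family.\<close>

lemma intensity_ge_of_risk_le:
  assumes c: "c_kernel K > 0" and beta: "\<beta> > 0" and A: "A > 0"
    and model: "\<And>E. E \<in> \<E> \<Longrightarrow> sparse_functional_model K \<beta> E"
    and order: "risk_has_order K \<beta> \<E>"
  shows "\<exists>c>0. \<forall>E\<in>\<E>. risk E \<le> ennreal (A / real (nsub E)) \<longrightarrow>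
    c * real (nsub E) powr (1 / (4 * \<beta>)) \<le> intensity E"
proof -
  obtain c1 where c1: "c1 > 0"
    and lower: "\<And>E. E \<in> \<E> \<Longrightarrow> ennreal (c1 * exp_rate K \<beta> E) \<le> risk E"
    using order unfolding risk_has_order_def by blast
  \<comment> \<open>This is the factor in front of the power of \<open>n\<close> in
    \<open>saturated_term_threshold\<close> at \<open>B = c1 / A\<close>.\<close>
  let ?c = "((c1 / A) powr ((2 * \<beta> + 1) / (2 * \<beta>)) / c_kernel K) powr (1 / 2)"
  have "?c * real (nsub E) powr (1 / (4 * \<beta>)) \<le> intensity E"
    if E: "E \<in> \<E>" and le: "risk E \<le> ennreal (A / real (nsub E))" for E
  proof -
    let ?n = "nsub E" and ?m = "intensity E"
    have n: "?n \<ge> 1" and m: "?m > 0"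
      using model[OF E] by (auto simp: sparse_functional_model_def random_counts_def)
    have "ennreal (c1 * exp_rate K \<beta> E) \<le> ennreal (A / real ?n)"
      using lower[OF E] le by (rule order_trans)
    then have "c1 * exp_rate K \<beta> E \<le> A / real ?n"
      using A by simp
    moreover have "saturated_term K \<beta> ?n ?m \<le> exp_rate K \<beta> E"
      using saturated_term_le_leading_term[OF c beta n m grp_pos[OF model[OF E]]]
      by (simp add: exp_rate_def rate_def add_increasing2)
    ultimately have "c1 * saturated_term K \<beta> ?n ?m \<le> A / real ?n"
      using c1 by (smt (verit) mult_left_mono)
    then have "saturated_term K \<beta> ?n ?m \<le> A / real ?n / c1"
      using c1 by (simp only: pos_le_divide_eq mult.commute)
    then have "saturated_term K \<beta> ?n ?m \<le> 1 / (c1 / A * real ?n)"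
      by (simp add: mult.commute)
    then show ?thesis
      using saturated_term_threshold(1)[OF c beta n m, of "c1 / A"] c1 A by simp
  qed
  moreover have "?c > 0"
    using c c1 A by simp
  ultimately show ?thesis
    by blast
qed

theorem corollary5p3:
  fixes K :: "real \<Rightarrow> real" and \<beta> R a b K0 :: real
    and \<E> :: "'w fda_experiment set"
  assumes beta: "0 < \<beta>" "\<beta> \<le> 2" and a_pos: "0 < a" and K0_pos: "0 < K0"
    and model: "\<And>E. E \<in> \<E> \<Longrightarrow> sparse_functional_model K \<beta> E"
    and A1: "\<And>E. E \<in> \<E> \<Longrightarrow> periodic_fun2 (covar E) \<and> holder_ball \<beta> R (covar E)"
    and A2: "\<And>E t. E \<in> \<E> \<Longrightarrow> a \<le> design E t \<and> design E t \<le> b"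
    and A3: "same_order_on \<E>
               (\<lambda>E. LINT \<omega>|prob E. real (obs_count E 0 \<omega>) * (real (obs_count E 0 \<omega>) - 1))
               (\<lambda>E. (intensity E)\<^sup>2)"
            "\<exists>c. \<forall>E\<in>\<E>. (LINT \<omega>|prob E. real (obs_count E 0 \<omega>) ^ 4) \<le> c * (intensity E) ^ 4"
    and A4: "\<And>E i t. E \<in> \<E> \<Longrightarrow> i < nsub E \<Longrightarrow> Lp_bounded (prob E) K0 (\<lambda>\<omega>. curve E i \<omega> t)"
            "\<And>E i j. E \<in> \<E> \<Longrightarrow> i < nsub E \<Longrightarrow> Lp_bounded (prob E) K0 (noise E i j)"
    and A5: "\<And>E q. E \<in> \<E> \<Longrightarrow> q \<in> insert (grp E) (enat ` set (cand_orders E)) \<Longrightarrow>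
               design_invariant q (design E)"
    and A6: "admissible_kernel K" "\<And>E. E \<in> \<E> \<Longrightarrow> 0 < bandwidth E \<and> bandwidth E < 1 / 4"
    and invariant: "\<And>E. E \<in> \<E> \<Longrightarrow> cov_invariant (grp E) (covar E)"
    and optimal: "rate_optimal_bandwidths K \<beta> \<E>"
    and risk_order: "risk_has_order K \<beta> \<E>"
  shows
    \<comment> \<open>the thresholds are well defined\<close>
    "(\<forall>n\<ge>1. \<exists>!m. is_threshold n (saturated_term K \<beta> n) m) \<and>
     (\<forall>n\<ge>1. \<forall>q>0. \<exists>!m. is_threshold n (\<lambda>m. leading_term K \<beta> n m q) m) \<and>
    \<comment> \<open>the saturated threshold, and the comparison with it for every order\<close>
     same_order_on {1..} (m_star K \<beta>)
       (\<lambda>n. c_kernel K powr (- 1 / 2) * real n powr (1 / (4 * \<beta>))) \<and>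
     (\<forall>n\<ge>1. \<forall>q>0. m_star K \<beta> n \<le> m_threshold K \<beta> n q) \<and>
    \<comment> \<open>no group, the full circle group included, lowers the threshold\<close>
     (\<exists>c>0. \<forall>n\<ge>1. \<forall>q>0. c * real n powr (1 / (4 * \<beta>)) \<le> m_threshold K \<beta> n q) \<and>
     (\<forall>A>0. \<exists>c>0. \<forall>E\<in>\<E>. risk E \<le> ennreal (A / real (nsub E)) \<longrightarrow>
        c * real (nsub E) powr (1 / (4 * \<beta>)) \<le> intensity E) \<and>
    \<comment> \<open>attainment\<close>
     (\<forall>n\<ge>1. m_threshold K \<beta> n (ereal (q_sharp K \<beta> n (m_star K \<beta> n))) = m_star K \<beta> n)"
proof -
  have c: "c_kernel K > 0"
    using A6(1) by (rule c_kernel_pos)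
  note star = m_star_eq[OF c beta(1)]
    and threshold = is_threshold_leading_iff[OF c beta(1)]
  have "\<forall>n\<ge>1. \<exists>!m. is_threshold n (saturated_term K \<beta> n) m"
    using is_threshold_saturated_iff[OF c beta(1)] by simp
  moreover have "\<forall>n\<ge>1. \<forall>q>0. \<exists>!m. is_threshold n (\<lambda>m. leading_term K \<beta> n m q) m"
    using threshold(1) by simp
  moreover have "same_order_on {1..} (m_star K \<beta>)
      (\<lambda>n. c_kernel K powr (- 1 / 2) * real n powr (1 / (4 * \<beta>)))"
    \<comment> \<open>The closed form of \<open>m_star\<close> is an equality, so both comparison
      constants are 1.\<close>
    unfolding same_order_on_def by (intro exI[of _ 1] conjI) (simp_all add: star)
  moreover have "\<forall>n\<ge>1. \<forall>q>0. m_star K \<beta> n \<le> m_threshold K \<beta> n q"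
    using threshold(2) by blast
  moreover from this
  have "\<exists>c>0. \<forall>n\<ge>1. \<forall>q>0. c * real n powr (1 / (4 * \<beta>)) \<le> m_threshold K \<beta> n q"
    \<comment> \<open>The constant is the prefactor in the closed form of \<open>m_star\<close>,
      hence independent of \<open>n\<close> and \<open>q\<close>.\<close>
    using c by (intro exI[of _ "c_kernel K powr (- 1 / 2)"]) (simp add: star)
  moreover have "\<forall>A>0. \<exists>c>0. \<forall>E\<in>\<E>. risk E \<le> ennreal (A / real (nsub E)) \<longrightarrow>
      c * real (nsub E) powr (1 / (4 * \<beta>)) \<le> intensity E"
    using intensity_ge_of_risk_le[OF c beta(1) _ model risk_order] by blast
  moreover have "\<forall>n\<ge>1. m_threshold K \<beta> n (ereal (q_sharp K \<beta> n (m_star K \<beta> n))) = m_star K \<beta> n"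
    using m_threshold_q_sharp[OF c beta(1)] by blast
  ultimately show ?thesis
    by blast
qed

end
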